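(* Let $L\colon A\to\mathbb{R}$ be a linear functional with $L(1)=1$ that is $\sum A^2$-positive, and let $\tau_{\mathcal{P}}$ be the topology on $A$ generated by the family of seminorms $\mathcal{P}:=\{p_d:d\in\mathbb{N}\}$. Then $\tau_{\mathcal{P}}$ is the weakest topology on $A$ such that $(A,\tau_{\mathcal{P}})$ is a locally convex topological algebra with continuous multiplication and $L$ is $\tau_{\mathcal{P}}$-continuous. (That is, $\tau_{\mathcal P}$ has these properties, and $\tau_{\mathcal P}\subseteq\tau$ for every topology $\tau$ on $A$ such that $(A,\tau)$ is a locally convex topological algebra with continuous multiplication and $L$ is $\tau$-continuous.)
   Context: $A$ is a unital commutative $\mathbb{R}$-algebra admitting at least one (unital) $\mathbb{R}$-algebra homomorphism to $\mathbb{R}$. $\sum A^2$-positive means $L(a^2)\ge0$ for all $a\in A$. For $d\in\mathbb{N}=\{1,2,\dots\}$, $p_d(a):=\sqrt[2^d]{L(a^{2^d})}$ for $a\in A$; each $p_d$ is a seminorm on $A$. A locally convex topology on $A$ is a topology generated by a family of seminorms (not necessarily Hausdorff). A pair $(A,\tau)$ with $\tau$ locally convex is a locally convex topological algebra with continuous multiplication if the multiplication $A\times A\to A$ is jointly continuous. *)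

theory Defs
  imports "HOL-Analysis.Analysis"
begin

definition real_algebra_hom ::
  "('a::real_algebra_1 \<Rightarrow> 'b::real_algebra_1) \<Rightarrow> bool" where
  "real_algebra_hom h \<longleftrightarrow>
     linear h \<and> h 1 = 1 \<and> (\<forall>a b. h (a * b) = h a * h b)"

text \<open>Nonnegativity of a seminorm follows from the two conditions.\<close>

definition seminorm :: "('a::real_vector \<Rightarrow> real) \<Rightarrow> bool" where
  "seminorm p \<longleftrightarrow>
     (\<forall>x y. p (x + y) \<le> p x + p y) \<and> (\<forall>c x. p (c *\<^sub>R x) = \<bar>c\<bar> * p x)"

text \<open>
  The translated open seminorm balls form a subbase. The set \<^term>\<open>UNIV\<close> is added so that the
  underlying set is the whole space also for the empty family, which generates the indiscrete
  topology.
\<close>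

definition seminorm_topology :: "('a::real_vector \<Rightarrow> real) set \<Rightarrow> 'a topology" where
  "seminorm_topology P =
     topology_generated_by (insert UNIV {{x. p (x - a) < r} | p a r. p \<in> P \<and> 0 < r})"

definition locally_convex_topology :: "'a::real_vector topology \<Rightarrow> bool" where
  "locally_convex_topology T \<longleftrightarrow>
     (\<exists>P. (\<forall>p\<in>P. seminorm p) \<and> T = seminorm_topology P)"

text \<open>Locally convex topological algebra with (jointly) continuous multiplication.\<close>

definition locally_convex_algebra_topology :: "'a::real_algebra topology \<Rightarrow> bool" where
  "locally_convex_algebra_topology T \<longleftrightarrow>
     locally_convex_topology T \<and> continuous_map (prod_topology T T) T (\<lambda>(a, b). a * b)"

definition square_positive :: "('a::real_algebra_1 \<Rightarrow> real) \<Rightarrow> bool" where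
  "square_positive L \<longleftrightarrow> (\<forall>a. 0 \<le> L (a\<^sup>2))"

definition power_seminorm :: "('a::real_algebra_1 \<Rightarrow> real) \<Rightarrow> nat \<Rightarrow> 'a \<Rightarrow> real" where
  "power_seminorm L d a = root (2 ^ d) (L (a ^ (2 ^ d)))"

definition power_seminorms :: "('a::real_algebra_1 \<Rightarrow> real) \<Rightarrow> ('a \<Rightarrow> real) set" where
  "power_seminorms L = {power_seminorm L d | d. 1 \<le> d}"

end

theory Submission
  imports Defs
begin

text \<open>
  Cauchy--Schwarz for the form \<open>(a, b) \<mapsto> L (a * b)\<close>, iterated, gives
  \<open>\<bar>L (a ^ i * b ^ j)\<bar> \<le> p\<^sub>d a ^ i * p\<^sub>d b ^ j\<close> whenever \<open>i + j = 2 ^ d\<close>. With the binomial theorem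
  this is the triangle inequality for \<open>p\<^sub>d\<close>; a single Cauchy--Schwarz step gives
  \<open>p\<^sub>d (a * b) \<le> p\<^sub>d\<^sub>+\<^sub>1 a * p\<^sub>d\<^sub>+\<^sub>1 b\<close> and \<open>\<bar>L a\<bar> \<le> p\<^sub>1 a\<close>, hence continuity of multiplication and of \<open>L\<close>.
  Conversely, if multiplication and \<open>L\<close> are continuous, then so is every map
  \<open>x \<mapsto> L ((x - a) ^ 2 ^ d)\<close>, and the balls of \<open>p\<^sub>d\<close> are its open sublevel sets.
\<close>

section \<open>Cauchy-Schwarz and mixed moments\<close>

lemma square_positive_Cauchy_Schwarz:
  fixes L :: "'a::{comm_ring_1, real_algebra_1} \<Rightarrow> real"
  assumes "linear L" "square_positive L"
  shows "(L (a * b))\<^sup>2 \<le> L (a\<^sup>2) * L (b\<^sup>2)"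
proof -
  interpret linear L by fact
  have nonneg: "0 \<le> L (x\<^sup>2)" for x
    using assms(2) by (simp add: square_positive_def)
  have quad: "0 \<le> L (a\<^sup>2) * t\<^sup>2 + 2 * L (a * b) * t + L (b\<^sup>2)" for t
  proof -
    have "(t *\<^sub>R a + b)\<^sup>2 = t\<^sup>2 *\<^sub>R a\<^sup>2 + (2 * t) *\<^sub>R (a * b) + b\<^sup>2"
      by (simp add: power2_eq_square algebra_simps scaleR_2 flip: scaleR_scaleR)
    then show ?thesis
      using nonneg[of "t *\<^sub>R a + b"] by (simp add: add scale algebra_simps)
  qed
  show ?thesis
  proof (cases "L (a\<^sup>2) = 0")
    case True
    have "L (a * b) = 0"
    proof (rule ccontr)
      assume "L (a * b) \<noteq> 0"
      \<comment> \<open>With \<open>L (a\<^sup>2) = 0\<close> the form in \<open>quad\<close> is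
        affine in \<open>t\<close>; this \<open>t\<close> makes it equal to -1.\<close>
      then show False
        using quad[of "- (L (b\<^sup>2) + 1) / (2 * L (a * b))"] True by simp
    qed
    then show ?thesis using True by simp
  next
    case False
    then have pos: "0 < L (a\<^sup>2)" using nonneg[of a] by simp
    \<comment> \<open>The right-hand side is the minimum of the quadratic, attained at the
      \<open>t\<close> inserted here.\<close>
    have "0 \<le> L (b\<^sup>2) - (L (a * b))\<^sup>2 / L (a\<^sup>2)"
      using quad[of "- L (a * b) / L (a\<^sup>2)"] pos
      by (simp add: power2_eq_square field_simps)
    then show ?thesis using pos by (simp add: field_simps)
  qed
qed

lemma square_positive_power:
  assumes "square_positive L" "1 \<le> d"
  shows "0 \<le> L (a ^ 2 ^ d)"
proof -
  have "a ^ 2 ^ d = (a ^ 2 ^ (d - 1))\<^sup>2"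
    using assms(2) by (cases d) (simp_all add: mult.commute flip: power_mult)
  then show ?thesis using assms(1) by (simp add: square_positive_def)
qed

text \<open>Free bounds \<open>s\<close> and \<open>t\<close> stand in for the roots, so that the
  induction can pass to \<open>a\<^sup>2\<close> and \<open>b\<^sup>2\<close> with bounds
  \<open>s\<^sup>2\<close> and \<open>t\<^sup>2\<close>: the \<open>2 ^ d\<close>-th power of a
  square is a \<open>2 ^ Suc d\<close>-th power.\<close>

lemma square_positive_mixed_moment_le:
  fixes L :: "'a::{comm_ring_1, real_algebra_1} \<Rightarrow> real"
  assumes "linear L" "square_positive L" "1 \<le> d" "i + j = 2 ^ d" "0 \<le> s" "0 \<le> t"
    and "L (a ^ 2 ^ d) \<le> s ^ 2 ^ d" "L (b ^ 2 ^ d) \<le> t ^ 2 ^ d"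
  shows "\<bar>L (a ^ i * b ^ j)\<bar> \<le> s ^ i * t ^ j"
  using assms(3-)
proof (induction d arbitrary: a b s t i j rule: dec_induct)
  case base
  have nonneg: "0 \<le> L (x\<^sup>2)" for x
    using assms(2) by (simp add: square_positive_def)
  \<comment> \<open>The two outer cases are the assumed bounds themselves; only the middle one needs
    Cauchy-Schwarz.\<close>
  consider "i = 2" "j = 0" | "i = 1" "j = 1" | "i = 0" "j = 2"
    using base.prems(1) by fastforce
  then show ?case
  proof cases
    case 2
    have "(L (a * b))\<^sup>2 \<le> L (a\<^sup>2) * L (b\<^sup>2)"
      using assms by (intro square_positive_Cauchy_Schwarz)
    also have "\<dots> \<le> s\<^sup>2 * t\<^sup>2"
      using base.prems nonneg by (intro mult_mono) auto
    finally have "\<bar>L (a * b)\<bar> \<le> s * t"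
      using base.prems by (metis abs_le_square_iff abs_of_nonneg mult_nonneg_nonneg power_mult_distrib)
    then show ?thesis using 2 by simp
  qed (use base.prems nonneg in simp_all)
next
  case (step d)
  have IH: "\<bar>L ((a\<^sup>2) ^ k * (b\<^sup>2) ^ l)\<bar> \<le> (s\<^sup>2) ^ k * (t\<^sup>2) ^ l" if "k + l = 2 ^ d" for k l
    using step.prems that by (intro step.IH) (simp_all flip: power_mult)
  show ?case
  proof (cases "even i")
    case True
    then have "even j" using step.prems(1) by (metis even_add even_numeral even_power zero_less_Suc)
    then obtain k l where "i = 2 * k" "j = 2 * l" using True by (elim evenE)
    then show ?thesis
      using IH[of k l] step.prems(1) by (simp add: power_mult)
  next
    case False
    then have "odd j" using step.prems(1) by (metis even_add even_numeral even_power zero_less_Suc)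
    then obtain k l where kl: "i = 2 * k + 1" "j = 2 * l + 1" using False by (elim oddE)
    have kl_sum: "k + l + 1 = 2 ^ d" using step.prems(1) kl by simp
    \<comment> \<open>Odd exponents are split unevenly: the squares of the two factors have
      exponents \<open>(2 * k + 2, 2 * l)\<close> and \<open>(2 * k, 2 * l + 2)\<close>, all even,
      so \<open>IH\<close> bounds both.\<close>
    have "(L (a ^ i * b ^ j))\<^sup>2 = (L ((a ^ (k + 1) * b ^ l) * (a ^ k * b ^ (l + 1))))\<^sup>2"
      by (simp add: kl power_add mult_2_right mult.commute[of 2] mult_ac)
    also have "\<dots> \<le> L ((a ^ (k + 1) * b ^ l)\<^sup>2) * L ((a ^ k * b ^ (l + 1))\<^sup>2)"
      using assms by (intro square_positive_Cauchy_Schwarz)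
    also have "\<dots> \<le> ((s\<^sup>2) ^ (k + 1) * (t\<^sup>2) ^ l) * ((s\<^sup>2) ^ k * (t\<^sup>2) ^ (l + 1))"
    proof (intro mult_mono)
      have eq: "(a ^ m * b ^ n)\<^sup>2 = (a\<^sup>2) ^ m * (b\<^sup>2) ^ n" for m n
        by (simp add: power_mult_distrib mult.commute flip: power_mult)
      show "L ((a ^ (k + 1) * b ^ l)\<^sup>2) \<le> (s\<^sup>2) ^ (k + 1) * (t\<^sup>2) ^ l"
        unfolding eq using IH[of "k + 1" l] kl_sum by auto
      show "L ((a ^ k * b ^ (l + 1))\<^sup>2) \<le> (s\<^sup>2) ^ k * (t\<^sup>2) ^ (l + 1)"
        unfolding eq using IH[of k "l + 1"] kl_sum by auto
    qed (use assms(2) in \<open>auto simp: square_positive_def\<close>)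
    also have "\<dots> = (s ^ i * t ^ j)\<^sup>2"
      by (simp add: kl power_mult power_mult_distrib power2_eq_square mult_ac)
    finally show ?thesis
      using step.prems by (metis abs_le_square_iff abs_of_nonneg mult_nonneg_nonneg zero_le_power)
  qed
qed

section \<open>The power seminorms\<close>

lemma power_seminorm_nonneg:
  "square_positive L \<Longrightarrow> 1 \<le> d \<Longrightarrow> 0 \<le> power_seminorm L d a"
  by (simp add: power_seminorm_def square_positive_power)

lemma power_seminorm_power:
  "square_positive L \<Longrightarrow> 1 \<le> d \<Longrightarrow> power_seminorm L d a ^ 2 ^ d = L (a ^ 2 ^ d)"
  by (simp add: power_seminorm_def square_positive_power)

text \<open>Trades the root for a bound on \<open>L\<close>, the form in which the mixed moment
  estimate arrives.\<close>

lemma power_seminorm_le_iff: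
  assumes "square_positive L" "1 \<le> d" "0 \<le> r"
  shows "power_seminorm L d a \<le> r \<longleftrightarrow> L (a ^ 2 ^ d) \<le> r ^ 2 ^ d"
  using power_mono_iff[of "power_seminorm L d a" r "2 ^ d"] assms
  by (simp add: power_seminorm_nonneg power_seminorm_power)

lemma seminorm_power_seminorm:
  fixes L :: "'a::{comm_ring_1, real_algebra_1} \<Rightarrow> real"
  assumes "linear L" "square_positive L" "1 \<le> d"
  shows "seminorm (power_seminorm L d)"
proof -
  interpret linear L by fact
  have "power_seminorm L d (a + b) \<le> power_seminorm L d a + power_seminorm L d b" for a b
  proof -
    define s t where "s = power_seminorm L d a" and "t = power_seminorm L d b"
    have st: "0 \<le> s" "0 \<le> t" "L (a ^ 2 ^ d) \<le> s ^ 2 ^ d" "L (b ^ 2 ^ d) \<le> t ^ 2 ^ d"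
      using assms by (simp_all add: s_def t_def power_seminorm_nonneg power_seminorm_power)
    have "L ((a + b) ^ 2 ^ d) =
        (\<Sum>k\<le>2 ^ d. of_nat (2 ^ d choose k) * L (a ^ k * b ^ (2 ^ d - k)))"
    proof -
      \<comment> \<open>The binomial coefficients are read as real scalars, so that linearity of
        \<open>L\<close> can pull them out.\<close>
      have "of_nat n * x = real n *\<^sub>R x" for n and x :: 'a
        by (simp add: scaleR_conv_of_real)
      then show ?thesis
        by (simp add: binomial_ring sum mult.assoc scale)
    qed
    also have "\<dots> \<le> (\<Sum>k\<le>2 ^ d. of_nat (2 ^ d choose k) * (s ^ k * t ^ (2 ^ d - k)))"
      using square_positive_mixed_moment_le[OF assms _ st]
      by (intro sum_mono mult_left_mono) (auto intro: order_trans[OF abs_ge_self])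
    also have "\<dots> = (s + t) ^ 2 ^ d"
      by (simp add: binomial_ring mult.assoc)
    finally show ?thesis
      using assms st by (simp add: power_seminorm_le_iff s_def t_def)
  qed
  moreover have "power_seminorm L d (c *\<^sub>R a) = \<bar>c\<bar> * power_seminorm L d a" for c a
  proof -
    \<comment> \<open>Since \<open>1 \<le> d\<close>, the exponent is even and the root returns the
      absolute value.\<close>
    have "root (2 ^ d) (c ^ 2 ^ d) = \<bar>c\<bar>"
      using assms(3) by (metis (no_types) even_numeral even_power power_even_abs
          real_root_power_cancel abs_ge_zero zero_less_numeral zero_less_power
          less_eq_Suc_le One_nat_def)
    moreover have "(c *\<^sub>R a) ^ 2 ^ d = c ^ 2 ^ d *\<^sub>R a ^ 2 ^ d"
      by (simp add: scaleR_conv_of_real power_mult_distrib)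
    ultimately show ?thesis
      by (simp add: power_seminorm_def scale real_root_mult)
  qed
  ultimately show ?thesis by (simp add: seminorm_def)
qed

text \<open>This is the balanced case \<open>i = j = 2 ^ d\<close> of the mixed moment bound at
  level \<open>Suc d\<close>. The shift by one level is harmless for the topology, as the family
  contains every level from 1 on.\<close>

lemma power_seminorm_mult_le:
  fixes L :: "'a::{comm_ring_1, real_algebra_1} \<Rightarrow> real"
  assumes "linear L" "square_positive L" "1 \<le> d"
  shows "power_seminorm L d (a * b) \<le> power_seminorm L (Suc d) a * power_seminorm L (Suc d) b"
proof -
  define s t where "s = power_seminorm L (Suc d) a" and "t = power_seminorm L (Suc d) b"
  have st: "0 \<le> s" "0 \<le> t" "L (a ^ 2 ^ Suc d) \<le> s ^ 2 ^ Suc d" "L (b ^ 2 ^ Suc d) \<le> t ^ 2 ^ Suc d"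
    using power_seminorm_power[OF assms(2), of "Suc d"]
    by (simp_all add: s_def t_def power_seminorm_nonneg[OF assms(2)] del: power_Suc)
  moreover have "\<bar>L (a ^ 2 ^ d * b ^ 2 ^ d)\<bar> \<le> s ^ 2 ^ d * t ^ 2 ^ d"
    by (rule square_positive_mixed_moment_le[OF assms(1,2) _ _ st]) simp_all
  then have "L ((a * b) ^ 2 ^ d) \<le> (s * t) ^ 2 ^ d"
    by (simp add: power_mult_distrib)
  ultimately show ?thesis
    using assms by (simp add: power_seminorm_le_iff s_def t_def)
qed

text \<open>The mixed moment \<open>L (a * 1)\<close> at level 1; the normalisation
  \<open>L 1 = 1\<close> makes 1 a valid bound for the second factor.\<close>

lemma abs_le_power_seminorm_1:
  fixes L :: "'a::{comm_ring_1, real_algebra_1} \<Rightarrow> real"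
  assumes "linear L" "L 1 = 1" "square_positive L"
  shows "\<bar>L a\<bar> \<le> power_seminorm L 1 a"
  using square_positive_mixed_moment_le[of L 1 1 1 "power_seminorm L 1 a" 1 a 1] assms
    power_seminorm_power[of L 1 a] power_seminorm_nonneg[of L 1 a]
  by simp

section \<open>Topologies generated by seminorms\<close>

lemma topspace_seminorm_topology [simp]: "topspace (seminorm_topology P) = UNIV"
  by (auto simp: seminorm_topology_def)

lemma openin_seminorm_ball:
  "p \<in> P \<Longrightarrow> 0 < r \<Longrightarrow> openin (seminorm_topology P) {x. p (x - a) < r}"
  unfolding seminorm_topology_def by (rule topology_generated_by_Basis) blast

lemma seminorm_0: "seminorm p \<Longrightarrow> p 0 = 0"
  unfolding seminorm_def by (metis abs_zero mult_zero_left scaleR_zero_left)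

lemma continuous_map_into_seminorm_topology:
  assumes "\<And>p a r. p \<in> P \<Longrightarrow> 0 < r \<Longrightarrow> openin T {x \<in> topspace T. p (f x - a) < r}"
  shows "continuous_map T (seminorm_topology P) f"
  unfolding seminorm_topology_def continuous_on_generated_topo_iff
proof (intro conjI allI impI)
  fix U assume "U \<in> insert UNIV {{x. p (x - a) < r} |p a r. p \<in> P \<and> 0 < r}"
  then consider "U = UNIV" | p a r where "U = {x. p (x - a) < r}" "p \<in> P" "0 < r"
    by blast
  then show "openin T (f -` U \<inter> topspace T)"
  proof cases
    case 2
    then show ?thesis using assms[of p r a] by (simp add: vimage_def Int_def conj_commute)
  qed simp
qed auto

text \<open>Comparison of topologies is continuity of the identity map, which is tested on the
  subbase.\<close>

lemma openin_seminorm_topology_mono: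
  assumes "topspace T = UNIV" "\<And>p a r. p \<in> P \<Longrightarrow> 0 < r \<Longrightarrow> openin T {x. p (x - a) < r}"
    and "openin (seminorm_topology P) U"
  shows "openin T U"
  using openin_continuous_map_preimage[OF continuous_map_into_seminorm_topology assms(3), of T "\<lambda>x. x"] assms
  by simp

text \<open>The preimage of a ball under a translation is again a ball, and the subbase has balls
  around every point.\<close>

lemma continuous_map_diff_seminorm_topology:
  "continuous_map (seminorm_topology P) (seminorm_topology P) (\<lambda>x. x - a)"
  by (rule continuous_map_into_seminorm_topology)
    (use openin_seminorm_ball in \<open>simp add: diff_diff_eq\<close>)

section \<open>Continuity of multiplication and of \<open>L\<close>\<close>

lemma continuous_map_mult_power_seminorms:
  fixes L :: "'a::{comm_ring_1, real_algebra_1} \<Rightarrow> real"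
  assumes "linear L" "square_positive L"
  defines "T \<equiv> seminorm_topology (power_seminorms L)"
  shows "continuous_map (prod_topology T T) T (\<lambda>(a, b). a * b)"
  unfolding T_def
proof (rule continuous_map_into_seminorm_topology, fold T_def)
  fix p c and r :: real assume "p \<in> power_seminorms L" "0 < r"
  then obtain d where d: "1 \<le> d" "p = power_seminorm L d"
    by (auto simp: power_seminorms_def)
  define q where "q = power_seminorm L (Suc d)"
  have q: "q \<in> power_seminorms L" "\<And>x. 0 \<le> q x" "q 0 = 0"
    using assms(2) seminorm_0[OF seminorm_power_seminorm[OF assms(1,2)], of "Suc d"]
    by (auto simp: q_def power_seminorms_def power_seminorm_nonneg)
  have pq: "p (x * y) \<le> q x * q y" for x y
    using assms d by (simp add: q_def power_seminorm_mult_le)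
  have tri: "p (x + y) \<le> p x + p y" for x y
    using seminorm_power_seminorm[OF assms(1,2) d(1)] by (simp add: d(2) seminorm_def)
  have "\<exists>U V. openin T U \<and> openin T V \<and> a \<in> U \<and> b \<in> V \<and>
      U \<times> V \<subseteq> {x. p ((case x of (a, b) \<Rightarrow> a * b) - c) < r}"
    if ab: "p (a * b - c) < r" for a b
  proof -
    \<comment> \<open>With \<open>u = x - a\<close> and \<open>v = y - b\<close>, expanding
      \<open>x * y - c\<close> yields the error terms \<open>u * v\<close>, \<open>u * b\<close> and
      \<open>a * v\<close>. As \<delta> \<le> 1, they cost at most \<delta>,
      \<open>\<delta> * q b\<close> and \<open>q a * \<delta>\<close>, in total
      \<open>\<delta> * K\<close>, which must fit into the slack
      \<open>r - p (a * b - c)\<close>.\<close>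
    define K where "K = 1 + q a + q b"
    define \<delta> where "\<delta> = min 1 ((r - p (a * b - c)) / K)"
    have K: "0 < K" using q(2)[of a] q(2)[of b] by (simp add: K_def)
    then have \<delta>: "0 < \<delta>" "\<delta> \<le> 1" "\<delta> * K \<le> r - p (a * b - c)"
      using ab by (auto simp: \<delta>_def min_def field_simps)
    have "p (x * y - c) < r" if "q (x - a) < \<delta>" "q (y - b) < \<delta>" for x y
    proof -
      define u v where "u = x - a" and "v = y - b"
      have uv: "q u < \<delta>" "q v < \<delta>" using that by (simp_all add: u_def v_def)
      have "x * y - c = u * v + (u * b + (a * v + (a * b - c)))"
        by (simp add: u_def v_def algebra_simps)
      then have "p (x * y - c) \<le> q u * q v + (q u * q b + (q a * q v + p (a * b - c)))"
        using tri pq by (smt (verit))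
      \<comment> \<open>Strictness comes from \<open>q u < \<delta>\<close> in the first term; the
        other two bounds can be equalities when \<open>q a\<close> and \<open>q b\<close>
        vanish.\<close>
      also have "\<dots> < \<delta> * 1 + (\<delta> * q b + (q a * \<delta> + p (a * b - c)))"
      proof -
        have "q u * q v \<le> q u * 1"
          using uv \<delta> q(2)[of u] by (intro mult_left_mono) auto
        moreover have "q u * q b \<le> \<delta> * q b" "q a * q v \<le> q a * \<delta>"
          using uv q(2) by (auto intro: mult_right_mono mult_left_mono)
        ultimately show ?thesis using uv by linarith
      qed
      also have "\<dots> = \<delta> * K + p (a * b - c)"
        by (simp add: K_def algebra_simps)
      also have "\<dots> \<le> r" using \<delta> by simp
      finally show ?thesis .
    qed
    then show ?thesis
      using openin_seminorm_ball[OF q(1) \<delta>(1)] \<delta>(1) q(3)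
      by (intro exI[of _ "{x. q (x - a) < \<delta>}"] exI[of _ "{x. q (x - b) < \<delta>}"]) (auto simp: T_def)
  qed
  then show "openin (prod_topology T T)
      {x \<in> topspace (prod_topology T T). p ((case x of (a, b) \<Rightarrow> a * b) - c) < r}"
    by (simp add: openin_prod_topology_alt T_def)
qed

lemma continuous_map_power_seminorms:
  fixes L :: "'a::{comm_ring_1, real_algebra_1} \<Rightarrow> real"
  assumes "linear L" "L 1 = 1" "square_positive L"
  shows "continuous_map (seminorm_topology (power_seminorms L)) euclideanreal L"
  unfolding continuous_map_def
proof (intro conjI allI impI)
  interpret linear L by fact
  let ?p = "power_seminorm L 1"
  have p: "?p \<in> power_seminorms L" "?p 0 = 0"
    using assms seminorm_0[OF seminorm_power_seminorm, of L 1]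
    by (auto simp: power_seminorms_def)
  fix U :: "real set" assume "openin euclideanreal U"
  then have U: "open U" by simp
  show "openin (seminorm_topology (power_seminorms L))
      {x \<in> topspace (seminorm_topology (power_seminorms L)). L x \<in> U}"
  proof (subst openin_subopen, intro ballI)
    fix a assume "a \<in> {x \<in> topspace (seminorm_topology (power_seminorms L)). L x \<in> U}"
    then obtain e where e: "0 < e" "ball (L a) e \<subseteq> U"
      using U open_contains_ball by blast
    \<comment> \<open>\<open>L\<close> is 1-Lipschitz for \<open>?p\<close>, so the radius
      \<open>e\<close> carries over unchanged.\<close>
    have "L x \<in> U" if "?p (x - a) < e" for x
    proof -
      have "\<bar>L x - L a\<bar> < e"
        using abs_le_power_seminorm_1[OF assms, of "x - a"] that by (simp add: diff)
      then show ?thesis using e(2) by (auto simp: dist_real_def)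
    qed
    then show "\<exists>S. openin (seminorm_topology (power_seminorms L)) S \<and> a \<in> S \<and>
        S \<subseteq> {x \<in> topspace (seminorm_topology (power_seminorms L)). L x \<in> U}"
      using openin_seminorm_ball[OF p(1) e(1)] p(2) e(1)
      by (intro exI[of _ "{x. ?p (x - a) < e}"]) auto
  qed
qed auto

section \<open>Minimality\<close>

text \<open>Translations are continuous by local convexity; each further factor is gained by
  composing the joint multiplication with the pair of \<open>x - a\<close> and its power.\<close>

lemma continuous_map_power_algebra:
  fixes T :: "'a::{comm_ring_1, real_algebra_1} topology"
  assumes "locally_convex_algebra_topology T"
  shows "continuous_map T T (\<lambda>x. (x - a) ^ n)"
proof (induction n)
  case 0
  have "topspace T = UNIV"
    using assms by (auto simp: locally_convex_algebra_topology_def locally_convex_topology_def)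
  then show ?case by simp
next
  case (Suc n)
  have "continuous_map T T (\<lambda>x. x - a)"
    using assms continuous_map_diff_seminorm_topology
    by (auto simp: locally_convex_algebra_topology_def locally_convex_topology_def)
  with Suc have "continuous_map T (prod_topology T T) (\<lambda>x. (x - a, (x - a) ^ n))"
    by (simp add: continuous_map_pairwise comp_def)
  then have "continuous_map T T ((\<lambda>(a, b). a * b) \<circ> (\<lambda>x. (x - a, (x - a) ^ n)))"
    using assms by (auto simp: locally_convex_algebra_topology_def intro: continuous_map_compose)
  then show ?case by (simp add: comp_def)
qed

lemma openin_power_seminorms_minimal:
  fixes L :: "'a::{comm_ring_1, real_algebra_1} \<Rightarrow> real"
  assumes "square_positive L" "locally_convex_algebra_topology T" "continuous_map T euclideanreal L"
    and "openin (seminorm_topology (power_seminorms L)) U"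
  shows "openin T U"
proof (rule openin_seminorm_topology_mono[OF _ _ assms(4)])
  show top: "topspace T = UNIV"
    using assms by (auto simp: locally_convex_algebra_topology_def locally_convex_topology_def)
  fix p a and r :: real assume "p \<in> power_seminorms L" "0 < r"
  then obtain d where d: "1 \<le> d" "p = power_seminorm L d"
    by (auto simp: power_seminorms_def)
  \<comment> \<open>Both sides are nonnegative, so \<open>2 ^ d\<close>-th powers preserve and
    reflect the strict inequality, which removes the root.\<close>
  have "p (x - a) < r \<longleftrightarrow> L ((x - a) ^ 2 ^ d) < r ^ 2 ^ d" for x
    using power_mono_iff[of r "p (x - a)" "2 ^ d"] assms(1) d \<open>0 < r\<close>
    by (simp add: power_seminorm_nonneg power_seminorm_power flip: not_le)
  then have "{x. p (x - a) < r} = {x \<in> topspace T. (L \<circ> (\<lambda>x. (x - a) ^ 2 ^ d)) x \<in> {..<r ^ 2 ^ d}}"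
    by (simp add: top)
  also have "openin T \<dots>"
    using continuous_map_compose[OF continuous_map_power_algebra[OF assms(2)] assms(3)]
    by (rule openin_continuous_map_preimage) simp
  finally show "openin T {x. p (x - a) < r}" .
qed

theorem proposition4p1:
  fixes L :: "'a::{comm_ring_1, real_algebra_1} \<Rightarrow> real"
  assumes "\<exists>h :: 'a \<Rightarrow> real. real_algebra_hom h"
    and "linear L" and "L 1 = 1" and "square_positive L"
  shows "locally_convex_algebra_topology (seminorm_topology (power_seminorms L)) \<and>
    continuous_map (seminorm_topology (power_seminorms L)) euclideanreal L \<and>
    (\<forall>T. locally_convex_algebra_topology T \<and> continuous_map T euclideanreal L \<longrightarrow>
      (\<forall>U. openin (seminorm_topology (power_seminorms L)) U \<longrightarrow> openin T U))"
proof -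
  have "\<forall>p\<in>power_seminorms L. seminorm p"
    using assms seminorm_power_seminorm by (auto simp: power_seminorms_def)
  \<comment> \<open>The family \<open>power_seminorms L\<close> itself witnesses local
    convexity.\<close>
  then have "locally_convex_algebra_topology (seminorm_topology (power_seminorms L))"
    using assms continuous_map_mult_power_seminorms
    by (auto simp: locally_convex_algebra_topology_def locally_convex_topology_def)
  then show ?thesis
    using assms continuous_map_power_seminorms openin_power_seminorms_minimal by blast
qed

end
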